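(* Let $\beta\in\mathbb{C}$ be an algebraic number such that $|\beta|>1$, and suppose that $|\beta'|\neq 1$ for each Galois conjugate $\beta'$ of $\beta$. Then there exists a finite set $\mathcal{A}\subset\mathbb{Z}$ such that $\operatorname{Per}_{\mathcal{A}}(\beta)=\mathbb{Q}(\beta)$.
   Context: An alphabet is a finite set $\mathcal{A}\subset\mathbb{C}$ containing $0$. For $\beta\in\mathbb{C}$ with $|\beta|>1$ and an alphabet $\mathcal{A}$, the set $\operatorname{Per}_{\mathcal{A}}(\beta)$ of numbers having an eventually periodic $(\beta,\mathcal{A})$-representation is $$\operatorname{Per}_{\mathcal{A}}(\beta)=\Big\{\sum_{k=-L}^{+\infty}a_k\beta^{-k}\ :\ L\in\mathbb{Z},\ a_k\in\mathcal{A}\text{ for all }k\ge -L,\ (a_k)_{k\geq -L}\text{ is eventually periodic}\Big\}.$$ The Galois conjugates of $\beta$ are the complex roots of its minimal polynomial over $\mathbb{Q}$ (including $\beta$ itself). *)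

theory Defs
  imports
    "HOL-Analysis.Analysis"
    "HOL-Algebra.Algebraic_Closure_Type"
    "HOL-Algebra.Generated_Fields"
begin

abbreviation complex_field :: "complex ring" where
  "complex_field \<equiv> ring_of_type_algebra"

text \<open>
  \<^term>\<open>ring.Irr complex_field \<rat> \<beta>\<close> is the monic irreducible polynomial over the rationals that
  vanishes at \<open>\<beta>\<close>. It is only meaningful for algebraic \<open>\<beta>\<close>.
\<close>
definition galois_conjugates :: "complex \<Rightarrow> complex set" where
  "galois_conjugates \<beta> = {z. ring.eval complex_field (ring.Irr complex_field \<rat> \<beta>) z = 0}"

text \<open>
  The prime field of \<open>\<complex>\<close> is \<open>\<rat>\<close>, so the subfield generated by \<open>\<beta>\<close> is precisely the field obtained by adjoining
  \<open>\<beta>\<close> to \<open>\<rat>\<close>.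
\<close>
definition rat_adjoin :: "complex \<Rightarrow> complex set" where
  "rat_adjoin \<beta> = generate_field complex_field {\<beta>}"

definition alphabet :: "complex set \<Rightarrow> bool" where
  "alphabet A \<longleftrightarrow> finite A \<and> 0 \<in> A"

text \<open>Values of \<open>a\<close> at indices below \<open>m\<close> play no role.\<close>
definition eventually_periodic_from :: "int \<Rightarrow> (int \<Rightarrow> 'a) \<Rightarrow> bool" where
  "eventually_periodic_from m a \<longleftrightarrow> (\<exists>N\<ge>m. \<exists>p>0. \<forall>k\<ge>N. a (k + p) = a k)"

text \<open>
  For \<open>norm \<beta> > 1\<close> and finite \<open>A\<close> the series converge absolutely, so the unordered sum over
  \<open>k \<ge> -L\<close> is the usual value of the series.
\<close>
definition Per :: "complex set \<Rightarrow> complex \<Rightarrow> complex set" where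
  "Per A \<beta> = {(\<Sum>\<^sub>\<infinity>k\<in>{-L..}. a k * \<beta> powi (-k)) | L a.
     (\<forall>k\<ge>-L. a k \<in> A) \<and> eventually_periodic_from (-L) a}"

end

theory Submission
  imports Defs
begin

text \<open>
  Let \<open>w = 1/\<beta>\<close>. Up to a power of \<open>\<beta>\<close>, a representation is a power series in \<open>w\<close> with an eventually periodic
  sequence of digits.

  An eventually periodic series sums to an element of \<open>\<rat>(\<beta>)\<close>, because multiplication by \<open>1 - w\<^sup>p\<close> turns it
  into a finite sum (\<open>expansion_in_rat_adjoin\<close>). The converse inclusion has two independent parts.

  The first part finds an eventually periodic representation of any \<open>x \<in> \<rat>(\<beta>)\<close> with arbitrary integer digits
  (\<open>rat_adjoin_representable\<close>). Let \<open>q\<close> be a positive integer with \<open>q x \<in> R = \<int>[\<beta>, 1/\<beta>]\<close>. As \<open>\<beta>\<close> is a unit of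
  the finite ring \<open>R / q R\<close>, some power satisfies \<open>\<beta>\<^sup>p - 1 = q h\<close> with \<open>h \<in> R\<close> (\<open>power_eq_one_mod\<close>). Then
  \<open>x = (q x) h / (\<beta>\<^sup>p - 1)\<close>, which expands as a finite combination of shifts of a periodic geometric series.

  The second part makes the digits small, within a bound that depends only on \<open>\<beta>\<close> (\<open>digit_reduction\<close>). It
  needs an integer relation \<open>\<Sum> s\<^sub>i \<beta>\<^bsup>n i\<^esup> = 0\<close> in which one coefficient exceeds twice the sum of the absolute
  values of all the others: subtracting suitable multiples of this relation at all positions at once shrinks large
  digits, and by a local rule, which respects periodicity. Here the hypothesis on the conjugates is essential. If
  no conjugate lies on the unit circle, replace all conjugates by their \<open>n\<close>-th powers. For large \<open>n\<close> the
  polynomial with these roots is dominated by the coefficient that belongs to the product of the conjugates of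
  modulus greater than one (\<open>dominant_integer_relation\<close>). For \<open>n\<close> a power of two, repeated root squaring keeps
  the coefficients integral.
\<close>

section \<open>Integer relations with a dominant coefficient\<close>

text \<open>
  Integer polynomials are kept as complex polynomials, so that they can be factored over the complex
  numbers without passing between two coefficient types.
\<close>
definition int_coeffs :: "complex poly \<Rightarrow> bool" where
  "int_coeffs p \<longleftrightarrow> (\<forall>i. poly.coeff p i \<in> \<int>)"

lemma int_coeffs_diff: "int_coeffs p \<Longrightarrow> int_coeffs q \<Longrightarrow> int_coeffs (p - q)"
  by (auto simp: int_coeffs_def)

lemma int_coeffs_mult: "int_coeffs p \<Longrightarrow> int_coeffs q \<Longrightarrow> int_coeffs (p * q)"
  by (auto simp: int_coeffs_def coeff_mult intro!: Ints_sum Ints_mult)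

lemma int_coeffs_pCons: "int_coeffs (pCons a p) \<longleftrightarrow> a \<in> \<int> \<and> int_coeffs p"
  by (auto simp: int_coeffs_def coeff_pCons split: nat.splits)

abbreviation sq_arg :: "complex poly" where
  "sq_arg \<equiv> [:0, 0, 1:]"

text \<open>
  The even and odd parts of a polynomial \<open>p\<close>, as polynomials in \<open>X\<^sup>2\<close>: prepending a coefficient swaps
  the two parts. They give \<open>p(X) p(-X) = E(X\<^sup>2)\<^sup>2 - X\<^sup>2 F(X\<^sup>2)\<^sup>2\<close>, which is visibly an integer
  polynomial in \<open>X\<^sup>2\<close>.
\<close>
lemma even_odd_decomposition:
  assumes "int_coeffs p"
  obtains E F where "int_coeffs E" "int_coeffs F"
    "p = E \<circ>\<^sub>p sq_arg + [:0, 1:] * (F \<circ>\<^sub>p sq_arg)"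
proof -
  have "\<exists>E F. int_coeffs E \<and> int_coeffs F \<and> p = E \<circ>\<^sub>p sq_arg + [:0, 1:] * (F \<circ>\<^sub>p sq_arg)"
    using assms
  proof (induction p)
    case 0
    then show ?case
      by (intro exI[of _ 0]) auto
  next
    case (pCons a p)
    then obtain E F where *: "int_coeffs E" "int_coeffs F"
      "p = E \<circ>\<^sub>p sq_arg + [:0, 1:] * (F \<circ>\<^sub>p sq_arg)"
      by (auto simp: int_coeffs_pCons)
    have "pCons a p = pCons a F \<circ>\<^sub>p sq_arg + [:0, 1:] * (E \<circ>\<^sub>p sq_arg)"
      by (subst *(3)) (simp add: pcompose_pCons algebra_simps)
    moreover have "int_coeffs (pCons a F)"
      using * pCons.prems by (auto simp: int_coeffs_pCons)
    ultimately show ?case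
      using *(1) by blast
  qed
  with that show thesis by blast
qed

text \<open>
  One step of Graeffe's root-squaring iteration. The product \<open>f(X) f(-X)\<close> is, up to a constant, the
  product of the \<open>X\<^sup>2 - z\<^sup>2\<close> over the roots \<open>z\<close> of \<open>f\<close>, and also \<open>g(X\<^sup>2)\<close> for an integer polynomial
  \<open>g\<close>. Comparison of the two shows that squaring the roots keeps integrality.
\<close>
lemma graeffe_step:
  assumes int: "int_coeffs (Polynomial.smult c (\<Prod>z\<in>#Z. [:-z, 1:]))" and "c \<noteq> 0"
  obtains c' where "c' \<noteq> 0" "int_coeffs (Polynomial.smult c' (\<Prod>z\<in>#Z. [:-(z ^ 2), 1:]))"
proof -
  let ?neg = "[:0, -1:] :: complex poly"
  define f where "f = Polynomial.smult c (\<Prod>z\<in>#Z. [:-z, 1:])"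
  obtain E F where EF: "int_coeffs E" "int_coeffs F"
    and f: "f = E \<circ>\<^sub>p sq_arg + [:0, 1:] * (F \<circ>\<^sub>p sq_arg)"
    using even_odd_decomposition int unfolding f_def by blast
  define g where "g = E * E - [:0, 1:] * (F * F)"
  have g_int: "int_coeffs g"
    unfolding g_def
    by (intro int_coeffs_diff int_coeffs_mult EF) (auto simp: int_coeffs_def coeff_pCons split: nat.splits)
  have sq_neg: "p \<circ>\<^sub>p sq_arg \<circ>\<^sub>p ?neg = p \<circ>\<^sub>p sq_arg" for p
    by (simp add: pcompose_assoc [symmetric] pcompose_pCons)
  have "f * (f \<circ>\<^sub>p ?neg) = g \<circ>\<^sub>p sq_arg"
    by (simp add: f g_def pcompose_add pcompose_diff pcompose_mult sq_neg pcompose_pCons algebra_simps)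
  moreover have "f * (f \<circ>\<^sub>p ?neg) =
      Polynomial.smult (c * c * (-1) ^ size Z) (\<Prod>z\<in>#Z. [:-(z ^ 2), 1:]) \<circ>\<^sub>p sq_arg"
  proof -
    have "(\<Prod>z\<in>#Z. [:-z, 1:]) * ((\<Prod>z\<in>#Z. [:-z, 1:]) \<circ>\<^sub>p ?neg) =
        Polynomial.smult ((-1) ^ size Z) ((\<Prod>z\<in>#Z. [:-(z ^ 2), 1:]) \<circ>\<^sub>p sq_arg)"
    proof (induction Z)
      case empty
      then show ?case by (simp add: pcompose_1)
    next
      case (add x Z)
      let ?P = "\<Prod>z\<in>#Z. [:-z, 1:]"
      have "[:-x, 1:] * ([:-x, 1:] \<circ>\<^sub>p ?neg) = Polynomial.smult (-1) ([:-(x ^ 2), 1:] \<circ>\<^sub>p sq_arg)"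
        by (simp add: pcompose_pCons power2_eq_square)
      moreover have "[:-x, 1:] * ?P * (([:-x, 1:] * ?P) \<circ>\<^sub>p ?neg) =
         ([:-x, 1:] * ([:-x, 1:] \<circ>\<^sub>p ?neg)) * (?P * (?P \<circ>\<^sub>p ?neg))"
        by (simp only: pcompose_mult mult_ac)
      ultimately show ?case
        by (simp only: add.IH image_mset_add_mset prod_mset.add_mset size_add_mset power_Suc
            pcompose_mult mult_smult_left mult_smult_right smult_smult mult_ac)
    qed
    then show ?thesis
      by (simp add: f_def pcompose_smult mult_ac)
  qed
  ultimately have "(g - Polynomial.smult (c * c * (-1) ^ size Z) (\<Prod>z\<in>#Z. [:-(z ^ 2), 1:])) \<circ>\<^sub>p sq_arg = 0"
    by (simp add: pcompose_diff)
  then have "g = Polynomial.smult (c * c * (-1) ^ size Z) (\<Prod>z\<in>#Z. [:-(z ^ 2), 1:])"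
    by (subst (asm) pcompose_eq_0_iff) auto
  with g_int \<open>c \<noteq> 0\<close> that[of "c * c * (-1) ^ size Z"] show thesis
    by simp
qed

lemma graeffe_iterate:
  assumes "int_coeffs (Polynomial.smult c (\<Prod>z\<in>#Z. [:-z, 1:]))" and "c \<noteq> 0"
  shows "\<exists>c'. c' \<noteq> 0 \<and> int_coeffs (Polynomial.smult c' (\<Prod>z\<in>#Z. [:-(z ^ (2 ^ k)), 1:]))"
proof (induction k)
  case 0
  then show ?case using assms by auto
next
  case (Suc k)
  then obtain c' where c': "c' \<noteq> 0" "int_coeffs (Polynomial.smult c' (\<Prod>z\<in>#image_mset (\<lambda>z. z ^ (2 ^ k)) Z. [:-z, 1:]))"
    by (auto simp: image_mset.compositionality o_def)
  from graeffe_step[OF c'(2,1)] obtain d where d: "d \<noteq> 0"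
    "int_coeffs (Polynomial.smult d (\<Prod>z\<in>#image_mset (\<lambda>z. z ^ (2 ^ k)) Z. [:-(z ^ 2), 1:]))"
    by blast
  then show ?case
    by (intro exI[of _ d])
      (simp add: image_mset.compositionality o_def power_mult [symmetric] mult_ac)
qed

text \<open>
  As \<open>n\<close> grows, the factor \<open>X - z\<^sup>n\<close> tends to \<open>X\<close> if \<open>|z| < 1\<close>, and after division by \<open>-z\<^sup>n\<close> it tends to
  \<open>1\<close> if \<open>|z| > 1\<close>. The normalised product therefore tends coefficientwise to \<open>X\<^sup>e\<close>, where \<open>e\<close> counts the
  elements of modulus less than one; on the unit circle neither normalisation would converge.
\<close>
lemma normalised_prod_tendsto_monom:
  assumes "\<And>z. z \<in># Z \<Longrightarrow> norm z \<noteq> (1 :: real)"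
  shows "\<exists>e \<le> size Z. \<exists>c :: nat \<Rightarrow> complex. (\<forall>n. c n \<noteq> 0) \<and>
    (\<forall>i. (\<lambda>n. poly.coeff (Polynomial.smult (c n) (\<Prod>z\<in>#Z. [:-(z ^ n), 1:])) i) \<longlonglongrightarrow> (if i = e then 1 else 0))"
  using assms
proof (induction Z)
  case empty
  show ?case
    by (intro exI[of _ 0] conjI exI[of _ "\<lambda>_. 1"]) (auto simp: coeff_pCons split: nat.splits)
next
  case (add x Z)
  then obtain e c where e: "e \<le> size Z" and c: "\<And>n. c n \<noteq> 0" and
    lim: "\<And>i. (\<lambda>n. poly.coeff (Polynomial.smult (c n) (\<Prod>z\<in>#Z. [:-(z ^ n), 1:])) i) \<longlonglongrightarrow> (if i = e then 1 else 0)"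
    by fastforce
  define P where "P = (\<lambda>n. Polynomial.smult (c n) (\<Prod>z\<in>#Z. [:-(z ^ n), 1:]))"
  have limP: "(\<lambda>n. poly.coeff (P n) i) \<longlonglongrightarrow> (if i = e then 1 else 0)" for i
    using lim by (simp add: P_def)
  have limP': "(\<lambda>n. poly.coeff (pCons 0 (P n)) i) \<longlonglongrightarrow> (if i = Suc e then 1 else 0)" for i
    using limP by (cases i) auto
  have nx: "norm x < 1 \<or> norm x > 1"
    using add.prems[of x] by auto
  then show ?case
  proof
    assume "norm x < 1"
    then have x0: "(\<lambda>n. x ^ n) \<longlonglongrightarrow> 0"
      by (rule LIMSEQ_power_zero)
    have eq: "Polynomial.smult (c n) (\<Prod>z\<in>#add_mset x Z. [:-(z ^ n), 1:]) = pCons 0 (P n) - Polynomial.smult (x ^ n) (P n)" for n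
      by (simp add: P_def smult_diff_right mult.commute)
    show ?thesis
    proof (intro exI[of _ "Suc e"] conjI exI[of _ c] allI c)
      fix i
      have "(\<lambda>n. poly.coeff (pCons 0 (P n)) i - x ^ n * poly.coeff (P n) i)
          \<longlonglongrightarrow> (if i = Suc e then 1 else 0) - 0 * (if i = e then 1 else 0)"
        by (intro tendsto_intros limP limP' x0)
      then show "(\<lambda>n. poly.coeff (Polynomial.smult (c n) (\<Prod>z\<in>#add_mset x Z. [:-(z ^ n), 1:])) i)
          \<longlonglongrightarrow> (if i = Suc e then 1 else 0)"
        unfolding eq coeff_diff coeff_smult by simp
    qed (use e in auto)
  next
    assume x1: "norm x > 1"
    then have x0: "(\<lambda>n. inverse x ^ n) \<longlonglongrightarrow> 0"
      by (intro LIMSEQ_power_zero) (simp add: norm_inverse inverse_less_1_iff)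
    have [simp]: "x \<noteq> 0" using x1 by auto
    have eq: "Polynomial.smult (- c n * inverse x ^ n) (\<Prod>z\<in>#add_mset x Z. [:-(z ^ n), 1:]) =
        P n - Polynomial.smult (inverse x ^ n) (pCons 0 (P n))" for n
      by (simp add: P_def smult_diff_right mult_ac power_inverse)
    show ?thesis
    proof (intro exI[of _ e] conjI exI[of _ "\<lambda>n. - c n * inverse x ^ n"] allI)
      fix i
      have "(\<lambda>n. poly.coeff (P n) i - inverse x ^ n * poly.coeff (pCons 0 (P n)) i)
          \<longlonglongrightarrow> (if i = e then 1 else 0) - 0 * (if i = Suc e then 1 else 0)"
        by (intro tendsto_intros limP limP' x0)
      then show "(\<lambda>n. poly.coeff (Polynomial.smult (- c n * inverse x ^ n) (\<Prod>z\<in>#add_mset x Z. [:-(z ^ n), 1:])) i)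
          \<longlonglongrightarrow> (if i = e then 1 else 0)"
        unfolding eq coeff_diff coeff_smult by simp
    qed (use e c in auto)
  qed
qed

text \<open>
  Far along the Graeffe iteration one coefficient dwarfs the sum of all the others, because the limit of
  the normalised polynomials is a monomial. The relation is between powers of \<open>\<beta>\<^sup>n\<close>, with \<open>n\<close> a power of two.
\<close>
lemma dominant_integer_relation:
  fixes p :: "complex poly"
  assumes int: "int_coeffs p" and "p \<noteq> 0" and root: "poly p \<beta> = 0"
    and unit: "\<And>z. poly p z = 0 \<Longrightarrow> norm z \<noteq> 1"
  obtains s :: "nat \<Rightarrow> int" and d e n :: nat
  where "e \<le> d" "n > 0" "2 * (\<Sum>i\<in>{..d} - {e}. \<bar>s i\<bar>) < \<bar>s e\<bar>"
    "(\<Sum>i\<le>d. of_int (s i) * \<beta> ^ (n * i)) = 0"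
proof -
  define Z where "Z = proots p"
  define Q where "Q = (\<lambda>n. \<Prod>z\<in>#Z. [:-(z ^ n), 1:])"
  have Z: "z \<in># Z \<longleftrightarrow> poly p z = 0" for z
    using \<open>p \<noteq> 0\<close> by (simp add: Z_def)
  obtain e c where e: "e \<le> size Z" and c: "\<And>n. c n \<noteq> 0"
    and lim: "\<And>i. (\<lambda>n. poly.coeff (Polynomial.smult (c n) (Q n)) i) \<longlonglongrightarrow> (if i = e then 1 else 0)"
    using normalised_prod_tendsto_monom[of Z] unit Z unfolding Q_def by blast
  define d where "d = size Z"
  \<comment> \<open>The excess of the coefficient at \<open>e\<close> over twice the others; it tends to 1.\<close>
  define \<Delta> where "\<Delta> = (\<lambda>n. norm (poly.coeff (Polynomial.smult (c n) (Q n)) e) -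
     2 * (\<Sum>i\<in>{..d} - {e}. norm (poly.coeff (Polynomial.smult (c n) (Q n)) i)))"
  have "(\<lambda>n. 2 * (\<Sum>i\<in>{..d} - {e}. norm (poly.coeff (Polynomial.smult (c n) (Q n)) i))) \<longlonglongrightarrow> 2 * (\<Sum>i\<in>{..d} - {e}. 0)"
  proof (intro tendsto_mult tendsto_const tendsto_sum)
    fix i assume "i \<in> {..d} - {e}"
    then show "(\<lambda>n. norm (poly.coeff (Polynomial.smult (c n) (Q n)) i)) \<longlonglongrightarrow> 0"
      using tendsto_norm[OF lim[of i]] by auto
  qed
  moreover have "(\<lambda>n. norm (poly.coeff (Polynomial.smult (c n) (Q n)) e)) \<longlonglongrightarrow> 1"
    using tendsto_norm[OF lim[of e]] by auto
  ultimately have "\<Delta> \<longlonglongrightarrow> 1 - 2 * (\<Sum>i\<in>{..d} - {e}. 0)"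
    unfolding \<Delta>_def by (intro tendsto_diff)
  then have "\<forall>\<^sub>F n in sequentially. \<Delta> n > 0"
    using order_tendstoD(1)[of \<Delta> 1 sequentially 0] by simp
  then obtain N where N: "\<And>n. n \<ge> N \<Longrightarrow> \<Delta> n > 0"
    by (auto simp: eventually_at_top_linorder)
  define n :: nat where "n = 2 ^ N"
  have n: "n > 0" "\<Delta> n > 0"
    using N[of n] less_exp[of N] by (auto simp: n_def)
  have "int_coeffs (Polynomial.smult (Polynomial.lead_coeff p) (\<Prod>z\<in>#Z. [:-z, 1:]))"
    using int by (simp add: Z_def complex_poly_decompose_multiset)
  then obtain c' where c': "c' \<noteq> 0" "int_coeffs (Polynomial.smult c' (Q n))"
    using graeffe_iterate[of "Polynomial.lead_coeff p" Z N] \<open>p \<noteq> 0\<close> unfolding n_def Q_def by auto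
  then have "\<forall>i. \<exists>k. poly.coeff (Polynomial.smult c' (Q n)) i = of_int k"
    by (auto simp: int_coeffs_def elim: Ints_cases)
  then obtain s where s: "\<And>i. poly.coeff (Polynomial.smult c' (Q n)) i = of_int (s i)"
    by metis
  have degQ: "Polynomial.degree (Polynomial.smult c' (Q n)) \<le> d"
  proof -
    have "Polynomial.degree (\<Prod>z\<in>#Z. [:-(z ^ n), 1:]) \<le> size Z" for Z :: "complex multiset"
    proof (induction Z)
      case (add x Z)
      have "Polynomial.degree ([:-(x ^ n), 1:] * (\<Prod>z\<in>#Z. [:-(z ^ n), 1:])) \<le> 1 + size Z"
        by (rule order.trans[OF degree_mult_le]) (use add.IH in simp)
      then show ?case
        by (simp only: image_mset_add_mset prod_mset.add_mset size_add_mset plus_1_eq_Suc)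
    qed simp
    then show ?thesis
      by (simp add: Q_def d_def)
  qed
  have \<beta>Z: "\<beta> \<in># Z"
    using Z root by simp
  have "poly (Q n) (\<beta> ^ n) = 0"
  proof -
    obtain Z' where "Z = add_mset \<beta> Z'"
      using \<beta>Z by (metis mset_add)
    then show ?thesis
      by (simp add: Q_def)
  qed
  then have "0 = poly (Polynomial.smult c' (Q n)) (\<beta> ^ n)"
    by simp
  also have "\<dots> = (\<Sum>i\<le>d. poly.coeff (Polynomial.smult c' (Q n)) i * (\<beta> ^ n) ^ i)"
    unfolding poly_altdef
    by (rule sum.mono_neutral_left) (use degQ in \<open>auto simp del: coeff_smult intro: coeff_eq_0\<close>)
  also have "\<dots> = (\<Sum>i\<le>d. of_int (s i) * \<beta> ^ (n * i))"
    by (simp only: s power_mult)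
  finally have rel: "(\<Sum>i\<le>d. of_int (s i) * \<beta> ^ (n * i)) = 0" ..
  define a where "a = norm (c' / c n)"
  have a: "a > 0" using c c' by (simp add: a_def)
  have s_abs: "a * norm (poly.coeff (Polynomial.smult (c n) (Q n)) i) = of_int \<bar>s i\<bar>" for i
  proof -
    have "of_int (s i) = c' / c n * poly.coeff (Polynomial.smult (c n) (Q n)) i"
      using s[of i] c[of n] by simp
    then have "norm (of_int (s i) :: complex) = a * norm (poly.coeff (Polynomial.smult (c n) (Q n)) i)"
      unfolding a_def by (metis norm_mult)
    then show ?thesis by simp
  qed
  have "a * \<Delta> n = of_int \<bar>s e\<bar> - 2 * (\<Sum>i\<in>{..d} - {e}. of_int \<bar>s i\<bar>)"
    unfolding \<Delta>_def right_diff_distrib mult.left_commute[of a 2] sum_distrib_left[of a] s_abs ..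
  also have "\<dots> = of_int (\<bar>s e\<bar> - 2 * (\<Sum>i\<in>{..d} - {e}. \<bar>s i\<bar>))"
    by simp
  finally have "real_of_int (\<bar>s e\<bar> - 2 * (\<Sum>i\<in>{..d} - {e}. \<bar>s i\<bar>)) > 0"
    using a n by (metis mult_pos_pos)
  then have "2 * (\<Sum>i\<in>{..d} - {e}. \<bar>s i\<bar>) < \<bar>s e\<bar>"
    by linarith
  then show thesis
    using that[of e d n s] e n rel by (simp add: d_def)
qed

section \<open>Eventually periodic expansions and digit reduction\<close>

definition ev_periodic :: "(nat \<Rightarrow> 'a) \<Rightarrow> bool" where
  "ev_periodic z \<longleftrightarrow> (\<exists>N. \<exists>p>0. \<forall>k\<ge>N. z (k + p) = z k)"

text \<open>
  Multiplication by the \<open>m\<close>-th power of the base of an expansion, seen on digit sequences.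
\<close>
definition shift :: "nat \<Rightarrow> (nat \<Rightarrow> 'a :: zero) \<Rightarrow> nat \<Rightarrow> 'a" where
  "shift m z k = (if k < m then 0 else z (k - m))"

lemma ev_periodic_const: "ev_periodic (\<lambda>_. c)"
  by (auto simp: ev_periodic_def)

lemma ev_periodic_shift:
  assumes "ev_periodic z"
  shows "ev_periodic (shift m z)"
proof -
  obtain N p where "p > 0" and p: "\<And>k. k \<ge> N \<Longrightarrow> z (k + p) = z k"
    using assms by (auto simp: ev_periodic_def)
  have "shift m z (k + p) = shift m z k" if "k \<ge> N + m" for k
    using p[of "k - m"] that by (simp add: shift_def)
  with \<open>p > 0\<close> show ?thesis
    unfolding ev_periodic_def by blast
qed

lemma ev_periodic_combine:
  assumes "ev_periodic x" "ev_periodic y"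
  shows "ev_periodic (\<lambda>k. f (x k) (y k))"
proof -
  obtain N p where "p > 0" and p: "\<And>k. k \<ge> N \<Longrightarrow> x (k + p) = x k"
    using assms by (auto simp: ev_periodic_def)
  obtain M q where "q > 0" and q: "\<And>k. k \<ge> M \<Longrightarrow> y (k + q) = y k"
    using assms by (auto simp: ev_periodic_def)
  have p': "x (k + j * p) = x k" if "k \<ge> N" for j k
  proof (induction j)
    case (Suc j)
    then show ?case using p[of "k + j * p"] that by (simp add: add_ac)
  qed simp
  have q': "y (k + j * q) = y k" if "k \<ge> M" for j k
  proof (induction j)
    case (Suc j)
    then show ?case using q[of "k + j * q"] that by (simp add: add_ac)
  qed simp
  have "\<forall>k\<ge>N + M. f (x (k + p * q)) (y (k + p * q)) = f (x k) (y k)"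
    using p'[of _ q] q'[of _ p] by (simp add: mult.commute)
  moreover have "p * q > 0" using \<open>p > 0\<close> \<open>q > 0\<close> by simp
  ultimately show ?thesis
    unfolding ev_periodic_def by blast
qed

lemma ev_periodic_comp: "ev_periodic x \<Longrightarrow> ev_periodic (\<lambda>k. f (x k))"
  using ev_periodic_combine[of x x "\<lambda>a _. f a"] by simp

lemma ev_periodic_sum:
  "(\<And>j. j \<in> J \<Longrightarrow> ev_periodic (z j)) \<Longrightarrow> ev_periodic (\<lambda>k. \<Sum>j\<in>J. z j k)"
  by (induction J rule: infinite_finite_induct) (auto intro: ev_periodic_combine ev_periodic_const)

lemma ev_periodic_finite_range:
  assumes "ev_periodic z"
  shows "finite (range z)"
proof -
  obtain N p where "p > 0" and p: "\<And>k. k \<ge> N \<Longrightarrow> z (k + p) = z k"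
    using assms by (auto simp: ev_periodic_def)
  have "z k \<in> z ` {..<N + p}" for k
  proof (induction k rule: less_induct)
    case (less k)
    show ?case
    proof (cases "k < N + p")
      case False
      then show ?thesis using less[of "k - p"] p[of "k - p"] \<open>p > 0\<close> by simp
    qed auto
  qed
  then show ?thesis
    by (intro finite_subset[of "range z" "z ` {..<N + p}"]) auto
qed

lemma ev_periodic_bounded:
  fixes z :: "nat \<Rightarrow> int"
  assumes "ev_periodic z"
  obtains M where "M \<ge> 0" "\<And>k. \<bar>z k\<bar> \<le> M"
proof
  show "0 \<le> Max ((\<lambda>a. \<bar>a\<bar>) ` range z)" "\<bar>z k\<bar> \<le> Max ((\<lambda>a. \<bar>a\<bar>) ` range z)" for k
    using ev_periodic_finite_range[OF assms]
    by (auto intro!: Max_ge order.trans[OF abs_ge_zero[of "z 0"]])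
qed

text \<open>
  The base is \<open>w = 1 / \<beta>\<close>, so that an expansion is an ordinary power series with integer coefficients,
  which converges for \<open>|w| < 1\<close> as soon as the coefficients are bounded.
\<close>
definition expansion :: "complex \<Rightarrow> (nat \<Rightarrow> int) \<Rightarrow> complex" where
  "expansion w z = (\<Sum>k. of_int (z k) * w ^ k)"

context
  fixes w :: complex
  assumes w: "norm w < 1"
begin

lemma expansion_norm_summable:
  assumes "ev_periodic z"
  shows "summable (\<lambda>k. norm (of_int (z k) * w ^ k))"
proof -
  obtain M where M: "\<And>k. \<bar>z k\<bar> \<le> M" "M \<ge> 0"
    using ev_periodic_bounded[OF assms] by metis
  show ?thesis
  proof (rule summable_comparison_test')
    show "summable (\<lambda>k. of_int M * norm w ^ k)"
      using w by (intro summable_mult summable_geometric) auto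
    show "norm (norm (of_int (z k) * w ^ k)) \<le> of_int M * norm w ^ k" if "k \<ge> 0" for k
    proof -
      have "real_of_int \<bar>z k\<bar> \<le> of_int M"
        using M(1)[of k] by linarith
      then show ?thesis
        by (simp add: norm_mult norm_power mult_right_mono)
    qed
  qed
qed

lemma expansion_sums:
  "ev_periodic z \<Longrightarrow> (\<lambda>k. of_int (z k) * w ^ k) sums expansion w z"
  unfolding expansion_def
  using expansion_norm_summable by (blast intro: summable_sums summable_norm_cancel)

lemma expansion_shift:
  assumes "ev_periodic z"
  shows "expansion w (shift m z) = w ^ m * expansion w z"
proof -
  have "(\<lambda>k. w ^ m * (of_int (z k) * w ^ k)) sums (w ^ m * expansion w z)"
    by (intro sums_mult expansion_sums assms)
  then have "(\<lambda>k. of_int (shift m z (k + m)) * w ^ (k + m)) sums (w ^ m * expansion w z)"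
    by (simp add: shift_def power_add mult_ac)
  then have "(\<lambda>k. of_int (shift m z k) * w ^ k) sums
      (w ^ m * expansion w z + (\<Sum>k<m. of_int (shift m z k) * w ^ k))"
    by (subst (asm) sums_iff_shift)
  then show ?thesis
    by (simp add: expansion_def sums_iff shift_def)
qed

lemma expansion_add:
  assumes "ev_periodic x" "ev_periodic y"
  shows "expansion w (\<lambda>k. x k + y k) = expansion w x + expansion w y"
proof -
  have "(\<lambda>k. of_int (x k) * w ^ k + of_int (y k) * w ^ k) sums (expansion w x + expansion w y)"
    by (intro sums_add expansion_sums assms)
  then show ?thesis
    by (simp add: expansion_def sums_iff algebra_simps)
qed

lemma expansion_mult:
  assumes "ev_periodic x"
  shows "expansion w (\<lambda>k. a * x k) = of_int a * expansion w x"
proof -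
  have "(\<lambda>k. of_int a * (of_int (x k) * w ^ k)) sums (of_int a * expansion w x)"
    by (intro sums_mult expansion_sums assms)
  then show ?thesis
    by (simp add: expansion_def sums_iff algebra_simps)
qed

lemma expansion_sum:
  assumes "\<And>j. j \<in> J \<Longrightarrow> ev_periodic (z j)"
  shows "expansion w (\<lambda>k. \<Sum>j\<in>J. z j k) = (\<Sum>j\<in>J. expansion w (z j))"
  using assms
proof (induction J rule: infinite_finite_induct)
  case (insert j J)
  then show ?case
    by (simp add: expansion_add ev_periodic_sum)
qed (simp_all add: expansion_def)

text \<open>
  Adding a multiple of the relation \<open>\<Sum> r\<^sub>j w\<^bsup>m j\<^esup> = 0\<close> at each position does not change the value
  of an expansion. If the multiplier at position \<open>k\<close> is the quotient \<open>t\<^sub>k\<close> of the digit \<open>z\<^sub>k\<close> by the dominant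
  coefficient \<open>r\<^sub>e\<close>, then a digit becomes its remainder, of size at most \<open>|r\<^sub>e|\<close>, plus carries from the other
  coefficients, of total size at most \<open>(M + |r\<^sub>e|) / 2\<close> for digits of size at most \<open>M\<close>. The sum is less than
  \<open>M\<close> once \<open>M > 3 |r\<^sub>e|\<close>. All carries are determined by the local digits, not propagated, so that eventual
  periodicity is preserved.
\<close>
lemma digit_reduction_step:
  fixes r :: "'j \<Rightarrow> int"
  assumes J: "finite J" "e \<in> J"
    and rel: "(\<Sum>j\<in>J. of_int (r j) * w ^ m j) = 0"
    and dom: "2 * (\<Sum>j\<in>J - {e}. \<bar>r j\<bar>) < \<bar>r e\<bar>"
    and z: "ev_periodic z" "\<And>k. \<bar>z k\<bar> \<le> M" and M: "M > 3 * \<bar>r e\<bar>"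
  obtains y where "ev_periodic y" "\<And>k. \<bar>y k\<bar> < M" "expansion w y = w ^ m e * expansion w z"
proof -
  define t where "t = (\<lambda>k. z k div r e)"
  define y where "y = (\<lambda>k. shift (m e) z k + (-1) * (\<Sum>j\<in>J. r j * shift (m j) t k))"
  have t: "ev_periodic t"
    unfolding t_def by (rule ev_periodic_comp[OF z(1)])
  have rt: "ev_periodic (\<lambda>k. r j * shift (m j) t k)" for j
    by (rule ev_periodic_comp[OF ev_periodic_shift[OF t]])
  have srt: "ev_periodic (\<lambda>k. \<Sum>j\<in>J. r j * shift (m j) t k)"
    by (intro ev_periodic_sum rt)
  have nsrt: "ev_periodic (\<lambda>k. (-1) * (\<Sum>j\<in>J. r j * shift (m j) t k))"
    by (rule ev_periodic_comp[OF srt])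
  have "ev_periodic y"
    unfolding y_def by (intro ev_periodic_combine[OF ev_periodic_shift[OF z(1)] nsrt])
  moreover have "expansion w y = w ^ m e * expansion w z"
  proof -
    have "expansion w y = w ^ m e * expansion w z - (\<Sum>j\<in>J. of_int (r j) * (w ^ m j * expansion w t))"
      unfolding y_def expansion_add[OF ev_periodic_shift[OF z(1)] nsrt] expansion_mult[OF srt]
        expansion_sum[OF rt] expansion_mult[OF ev_periodic_shift[OF t]]
        expansion_shift[OF t] expansion_shift[OF z(1)] by simp
    also have "(\<Sum>j\<in>J. of_int (r j) * (w ^ m j * expansion w t)) =
        (\<Sum>j\<in>J. of_int (r j) * w ^ m j) * expansion w t"
      by (simp add: sum_distrib_right mult.assoc)
    finally show ?thesis
      using rel by simp
  qed
  moreover have "\<bar>y k\<bar> < M" for k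
  proof -
    have re: "\<bar>r e\<bar> > 0"
      using dom sum_nonneg[of "J - {e}" "\<lambda>j. \<bar>r j\<bar>"] by linarith
    have mod_bound: "\<bar>z i mod r e\<bar> < \<bar>r e\<bar>" for i
      using re abs_mod_less[of "r e" "z i"] by auto
    have t_bound: "\<bar>r e\<bar> * \<bar>shift i t l\<bar> \<le> M + \<bar>r e\<bar>" for i l
    proof (cases "l < i")
      case False
      have "r e * t (l - i) = z (l - i) - z (l - i) mod r e"
        by (simp add: t_def minus_mod_eq_mult_div)
      then have "\<bar>r e * t (l - i)\<bar> \<le> M + \<bar>r e\<bar>"
        using z(2)[of "l - i"] mod_bound[of "l - i"] by linarith
      then show ?thesis using False by (simp add: shift_def abs_mult)
    qed (use M in \<open>simp add: shift_def\<close>)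
    \<comment> \<open>The carries that arrive at position \<open>k\<close> from the non-dominant coefficients.\<close>
    define R where "R = (\<Sum>j\<in>J - {e}. r j * shift (m j) t k)"
    have "\<bar>r e\<bar> * \<bar>R\<bar> \<le> \<bar>r e\<bar> * (\<Sum>j\<in>J - {e}. \<bar>r j * shift (m j) t k\<bar>)"
      unfolding R_def by (intro mult_left_mono sum_abs) auto
    also have "\<dots> = (\<Sum>j\<in>J - {e}. \<bar>r j\<bar> * (\<bar>r e\<bar> * \<bar>shift (m j) t k\<bar>))"
      by (simp add: sum_distrib_left abs_mult mult_ac)
    also have "\<dots> \<le> (\<Sum>j\<in>J - {e}. \<bar>r j\<bar> * (M + \<bar>r e\<bar>))"
      by (intro sum_mono mult_left_mono t_bound) auto
    also have "\<dots> = (\<Sum>j\<in>J - {e}. \<bar>r j\<bar>) * (M + \<bar>r e\<bar>)"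
      by (simp add: sum_distrib_right)
    finally have "\<bar>r e\<bar> * (2 * \<bar>R\<bar>) \<le> (2 * (\<Sum>j\<in>J - {e}. \<bar>r j\<bar>)) * (M + \<bar>r e\<bar>)"
      by linarith
    also have "\<dots> \<le> \<bar>r e\<bar> * (M + \<bar>r e\<bar>)"
      using dom M by (intro mult_right_mono) linarith+
    finally have R_bound: "2 * \<bar>R\<bar> \<le> M + \<bar>r e\<bar>"
      using re by (simp only: mult_le_cancel_left_pos)
    have "y k = (shift (m e) z k - r e * shift (m e) t k) - R"
      unfolding y_def R_def by (subst sum.remove[OF J]) simp
    moreover have "\<bar>shift (m e) z k - r e * shift (m e) t k\<bar> \<le> \<bar>r e\<bar>"
      using mod_bound[of "k - m e"] by (simp add: shift_def t_def minus_mult_div_eq_mod)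
    ultimately show ?thesis
      using R_bound M re by linarith
  qed
  ultimately show thesis
    using that by blast
qed

text \<open>
  The bound on the digits is an integer, and each step lowers it until it is at most \<open>3 |r\<^sub>e|\<close>. The final bound
  is independent of the given sequence, which is why one alphabet serves all numbers; only the shift \<open>L\<close>
  depends on it.
\<close>
lemma digit_reduction:
  fixes r :: "'j \<Rightarrow> int"
  assumes J: "finite J" "e \<in> J"
    and rel: "(\<Sum>j\<in>J. of_int (r j) * w ^ m j) = 0"
    and dom: "2 * (\<Sum>j\<in>J - {e}. \<bar>r j\<bar>) < \<bar>r e\<bar>"
    and z: "ev_periodic z"
  obtains y L where "ev_periodic y" "\<And>k. \<bar>y k\<bar> \<le> 3 * \<bar>r e\<bar>" "expansion w y = w ^ L * expansion w z"
proof -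
  have "\<exists>y L. ev_periodic y \<and> (\<forall>k. \<bar>y k\<bar> \<le> 3 * \<bar>r e\<bar>) \<and> expansion w y = w ^ L * expansion w z"
    if "ev_periodic z" "\<And>k. \<bar>z k\<bar> \<le> M" for z M
    using that
  proof (induction "nat M" arbitrary: M z rule: less_induct)
    case (less M z)
    show ?case
    proof (cases "M > 3 * \<bar>r e\<bar>")
      case True
      obtain y where y: "ev_periodic y" "\<And>k. \<bar>y k\<bar> < M" "expansion w y = w ^ m e * expansion w z"
        using digit_reduction_step[OF J rel dom less.prems True] by blast
      have "nat (M - 1) < nat M"
        using True by linarith
      moreover have "\<bar>y k\<bar> \<le> M - 1" for k
        using y(2)[of k] by linarith
      ultimately obtain y' L where y': "ev_periodic y'" "\<forall>k. \<bar>y' k\<bar> \<le> 3 * \<bar>r e\<bar>"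
        "expansion w y' = w ^ L * expansion w y"
        using less.hyps[of "M - 1" y] y(1) by blast
      from y'(3) have "expansion w y' = w ^ (L + m e) * expansion w z"
        by (simp add: y(3) power_add)
      with y' show ?thesis by blast
    next
      case False
      have "expansion w z = w ^ 0 * expansion w z"
        by simp
      moreover have "\<forall>k. \<bar>z k\<bar> \<le> 3 * \<bar>r e\<bar>"
        using less.prems(2) False by (meson not_le order.trans)
      ultimately show ?thesis
        using less.prems(1) by blast
    qed
  qed
  moreover obtain M where "\<And>k. \<bar>z k\<bar> \<le> M"
    using ev_periodic_bounded[OF z] by metis
  ultimately show thesis
    using that z by blast
qed

end

section \<open>Powers congruent to one in \<open>\<int>[\<beta>, 1/\<beta>]\<close>\<close>

text \<open>
  The ring \<open>\<int>[\<beta>, 1/\<beta>]\<close>, generated by rules instead of Laurent polynomials, so that closure properties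
  of other sets under its action follow by induction.
\<close>
inductive_set laurent_ring :: "complex \<Rightarrow> complex set" for \<beta> :: complex where
  one: "1 \<in> laurent_ring \<beta>"
| add: "x \<in> laurent_ring \<beta> \<Longrightarrow> y \<in> laurent_ring \<beta> \<Longrightarrow> x + y \<in> laurent_ring \<beta>"
| neg: "x \<in> laurent_ring \<beta> \<Longrightarrow> - x \<in> laurent_ring \<beta>"
| mult_base: "x \<in> laurent_ring \<beta> \<Longrightarrow> \<beta> * x \<in> laurent_ring \<beta>"
| divide_base: "x \<in> laurent_ring \<beta> \<Longrightarrow> x / \<beta> \<in> laurent_ring \<beta>"

lemma laurent_ring_diff:
  "x \<in> laurent_ring \<beta> \<Longrightarrow> y \<in> laurent_ring \<beta> \<Longrightarrow> x - y \<in> laurent_ring \<beta>"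
  using laurent_ring.add[of x \<beta> "- y"] laurent_ring.neg[of y \<beta>] by simp

lemma laurent_ring_zero: "0 \<in> laurent_ring \<beta>"
  using laurent_ring_diff[OF laurent_ring.one laurent_ring.one] by simp

lemma laurent_ring_mult:
  assumes "x \<in> laurent_ring \<beta>" "y \<in> laurent_ring \<beta>"
  shows "x * y \<in> laurent_ring \<beta>"
  using assms
proof (induction x rule: laurent_ring.induct)
  case (mult_base x)
  then show ?case
    using laurent_ring.mult_base[of "x * y"] by (simp add: mult.assoc)
next
  case (divide_base x)
  then show ?case
    using laurent_ring.divide_base[of "x * y"] by simp
qed (auto simp: distrib_right intro: laurent_ring.intros)

lemma laurent_ring_sum:
  "(\<And>i. i \<in> A \<Longrightarrow> f i \<in> laurent_ring \<beta>) \<Longrightarrow> sum f A \<in> laurent_ring \<beta>"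
  by (induction A rule: infinite_finite_induct) (auto intro: laurent_ring_zero laurent_ring.add)

lemma laurent_ring_of_int: "of_int a \<in> laurent_ring \<beta>"
proof -
  have "of_nat n \<in> laurent_ring \<beta>" for n
    by (induction n) (auto intro: laurent_ring_zero laurent_ring.one laurent_ring.add)
  then show ?thesis
    by (cases a rule: int_cases2) (auto intro: laurent_ring.neg)
qed

lemma laurent_ring_of_nat: "of_nat n \<in> laurent_ring \<beta>"
  using laurent_ring_of_int[of "int n"] by simp

lemma laurent_ring_power: "\<beta> ^ n \<in> laurent_ring \<beta>"
  by (induction n) (auto intro: laurent_ring.one laurent_ring.mult_base)

lemma laurent_ring_divide_power: "x \<in> laurent_ring \<beta> \<Longrightarrow> x / \<beta> ^ n \<in> laurent_ring \<beta>"
proof (induction n)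
  case (Suc n)
  then show ?case
    using laurent_ring.divide_base[of "x / \<beta> ^ n"] by (simp add: mult.commute)
qed simp

definition laurent_ideal :: "complex \<Rightarrow> nat \<Rightarrow> complex set" where
  "laurent_ideal \<beta> q = (*) (of_nat q) ` laurent_ring \<beta>"

lemma laurent_idealI: "h \<in> laurent_ring \<beta> \<Longrightarrow> of_nat q * h \<in> laurent_ideal \<beta> q"
  by (auto simp: laurent_ideal_def)

lemma laurent_idealE:
  assumes "x \<in> laurent_ideal \<beta> q"
  obtains h where "h \<in> laurent_ring \<beta>" "x = of_nat q * h"
  using assms by (auto simp: laurent_ideal_def)

lemma laurent_ideal_add:
  "x \<in> laurent_ideal \<beta> q \<Longrightarrow> y \<in> laurent_ideal \<beta> q \<Longrightarrow> x + y \<in> laurent_ideal \<beta> q"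
  by (metis laurent_idealE laurent_idealI laurent_ring.add distrib_left)

lemma laurent_ideal_diff:
  "x \<in> laurent_ideal \<beta> q \<Longrightarrow> y \<in> laurent_ideal \<beta> q \<Longrightarrow> x - y \<in> laurent_ideal \<beta> q"
  by (metis laurent_idealE laurent_idealI laurent_ring_diff right_diff_distrib)

lemma laurent_ideal_mult:
  "x \<in> laurent_ideal \<beta> q \<Longrightarrow> y \<in> laurent_ring \<beta> \<Longrightarrow> x * y \<in> laurent_ideal \<beta> q"
  by (metis laurent_idealE laurent_idealI laurent_ring_mult mult.assoc)

lemma laurent_ideal_zero: "0 \<in> laurent_ideal \<beta> q"
  using laurent_idealI[OF laurent_ring_zero] by simp

lemma laurent_ideal_sum:
  "(\<And>i. i \<in> A \<Longrightarrow> f i \<in> laurent_ideal \<beta> q) \<Longrightarrow> sum f A \<in> laurent_ideal \<beta> q"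
  by (induction A rule: infinite_finite_induct) (auto intro: laurent_ideal_zero laurent_ideal_add)

lemma laurent_ideal_of_int:
  assumes "int q dvd a" "x \<in> laurent_ring \<beta>"
  shows "of_int a * x \<in> laurent_ideal \<beta> q"
proof -
  obtain b where "a = int q * b" using assms by (elim dvdE)
  then show ?thesis
    using laurent_idealI[OF laurent_ring_mult[OF laurent_ring_of_int assms(2), of b], of q]
    by (simp add: mult.assoc)
qed

text \<open>
  Modulo a prime \<open>l\<close>, a primitive integer polynomial \<open>s\<close> does not vanish; let \<open>d\<close> be its degree modulo
  \<open>l\<close>. Its coefficient at \<open>d\<close> is invertible modulo \<open>l\<close>, so that the relation \<open>s(\<beta>) = 0\<close> expresses \<open>\<beta>\<^sup>d\<close>, and
  then every power of \<open>\<beta>\<close>, as a combination of \<open>1, \<dots>, \<beta>\<^bsup>d-1\<^esup>\<close> with coefficients among the residues modulo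
  \<open>l\<close>. There are finitely many such combinations, hence two powers of \<open>\<beta>\<close> agree modulo \<open>l\<close>, and \<open>\<beta>\<close> is
  a unit of the ring.
\<close>
lemma power_eq_one_mod_prime:
  fixes s :: "int poly"
  assumes "Factorial_Ring.prime l" and content: "content s = 1" and root: "poly (map_poly of_int s) \<beta> = 0"
    and "\<beta> \<noteq> 0"
  obtains p where "p > 0" "\<beta> ^ p - 1 \<in> laurent_ideal \<beta> l"
proof -
  let ?I = "laurent_ideal \<beta> l"
  define a where "a = poly.coeff s"
  define D where "D = Polynomial.degree s"
  define d where "d = Max {i. \<not> int l dvd a i}"
  have "{i. \<not> int l dvd a i} \<subseteq> {..D}"
    by (auto simp: a_def D_def intro!: le_degree)
  then have fin: "finite {i. \<not> int l dvd a i}"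
    by (rule finite_subset) simp
  have ne: "{i. \<not> int l dvd a i} \<noteq> {}"
  proof
    assume "{i. \<not> int l dvd a i} = {}"
    then have "[:int l:] dvd s"
      by (auto simp: a_def const_poly_dvd_iff)
    then have "int l dvd 1"
      using content by (simp add: const_poly_dvd_iff_dvd_content)
    then show False
      using \<open>Factorial_Ring.prime l\<close> by (auto simp: prime_nat_iff)
  qed
  have d: "\<not> int l dvd a d"
    using Max_in[OF fin ne] by (simp add: d_def)
  have above_d: "int l dvd a i" if "i > d" for i
    using Max_ge[OF fin, of i] that by (force simp: d_def [symmetric])
  have "d \<le> D"
    using d by (auto simp: a_def D_def intro!: le_degree)
  have "gcd (a d) (int l) = 1"
    using prime_imp_coprime[of "int l" "a d"] d \<open>Factorial_Ring.prime l\<close>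
    by (simp add: coprime_iff_gcd_eq_1 gcd.commute)
  then obtain u v where uv: "u * a d + v * int l = 1"
    using bezout_int[of "a d" "int l"] by auto

  define B where "B = (\<lambda>c :: nat \<Rightarrow> int. \<Sum>i<d. of_int (c i) * \<beta> ^ i)"
  have top: "\<beta> ^ d - B (\<lambda>i. - u * a i) \<in> ?I"
  proof -
    have "0 = (\<Sum>i\<le>D. of_int (a i) * \<beta> ^ i)"
      using root by (simp add: poly_altdef coeff_map_poly a_def D_def degree_map_poly)
    also have "{..D} = {..<d} \<union> ({d} \<union> {d<..D})"
      using \<open>d \<le> D\<close> by auto
    also have "(\<Sum>i\<in>\<dots>. of_int (a i) * \<beta> ^ i) =
        B a + (of_int (a d) * \<beta> ^ d + (\<Sum>i\<in>{d<..D}. of_int (a i) * \<beta> ^ i))"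
      unfolding B_def by (subst sum.union_disjoint, auto)+
    finally have "B a + (of_int (a d) * \<beta> ^ d + (\<Sum>i\<in>{d<..D}. of_int (a i) * \<beta> ^ i)) = 0" ..
    then have ad: "of_int (a d) * \<beta> ^ d = - B a - (\<Sum>i\<in>{d<..D}. of_int (a i) * \<beta> ^ i)"
      by (simp only: eq_diff_eq eq_neg_iff_add_eq_0 add_ac)
    have "\<beta> ^ d = of_int (u * a d + v * int l) * \<beta> ^ d"
      by (simp add: uv)
    also have "\<dots> = of_int u * (of_int (a d) * \<beta> ^ d) + of_int (v * int l) * \<beta> ^ d"
      by (simp add: algebra_simps)
    also have "\<dots> = - of_int u * B a - (\<Sum>i\<in>{d<..D}. of_int (a i) * \<beta> ^ i) * of_int u
        + of_int (v * int l) * \<beta> ^ d"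
      unfolding ad by (simp add: algebra_simps)
    also have "- of_int u * B a = B (\<lambda>i. - u * a i)"
      by (simp add: B_def sum_distrib_left mult.assoc sum_negf)
    finally have "\<beta> ^ d - B (\<lambda>i. - u * a i) =
       of_int (v * int l) * \<beta> ^ d - (\<Sum>i\<in>{d<..D}. of_int (a i) * \<beta> ^ i) * of_int u"
      by (simp only: diff_eq_eq) (simp only: add_ac diff_conv_add_uminus)
    moreover have "\<dots> \<in> ?I"
      by (intro laurent_ideal_diff laurent_ideal_mult laurent_ideal_sum laurent_ideal_of_int
          laurent_ring_power laurent_ring_of_int) (use above_d in auto)
    ultimately show ?thesis by simp
  qed
  \<comment> \<open>Multiplication by \<open>\<beta>\<close> moves only the last coefficient out of range, where \<open>top\<close> replaces it.\<close>
  have step: "\<exists>c'. \<beta> * x - B c' \<in> ?I" if "x - B c \<in> ?I" for x c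
  proof -
    have *: "\<beta> * x - \<beta> * B c \<in> ?I"
      using laurent_ideal_mult[OF that laurent_ring_power[of _ 1]] by (simp add: algebra_simps)
    show ?thesis
    proof (cases d)
      case 0
      then show ?thesis using * by (auto simp: B_def)
    next
      case (Suc d')
      define b where "b = (\<lambda>i. case i of 0 \<Rightarrow> 0 | Suc j \<Rightarrow> c j)"
      have "\<beta> * B c = (\<Sum>i<d'. of_int (c i) * \<beta> ^ Suc i) + of_int (c d') * \<beta> ^ d"
        by (simp add: B_def Suc sum_distrib_left algebra_simps)
      also have "(\<Sum>i<d'. of_int (c i) * \<beta> ^ Suc i) = B b"
        by (simp add: B_def Suc sum.lessThan_Suc_shift b_def del: sum.lessThan_Suc)
      finally have Bc: "\<beta> * B c = B b + of_int (c d') * \<beta> ^ d" .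
      have "B (\<lambda>i. b i + c d' * (- u * a i)) = B b + of_int (c d') * B (\<lambda>i. - u * a i)"
        by (simp add: B_def sum_distrib_left sum.distrib algebra_simps sum_negf sum_subtractf)
      then have "\<beta> * x - B (\<lambda>i. b i + c d' * (- u * a i)) =
        (\<beta> * x - \<beta> * B c) + (\<beta> ^ d - B (\<lambda>i. - u * a i)) * of_int (c d')"
        by (simp only: Bc) (simp add: algebra_simps)
      also have "\<dots> \<in> ?I"
        by (intro laurent_ideal_add * laurent_ideal_mult top laurent_ring_of_int)
      finally show ?thesis by blast
    qed
  qed
  have "\<exists>c. \<beta> ^ n - B c \<in> ?I" for n
  proof (induction n)
    case 0
    show ?case
    proof (cases d)
      case 0
      then show ?thesis using top by auto
    next
      case (Suc d')
      have "\<beta> ^ 0 - B (\<lambda>i. if i = 0 then 1 else 0) = 0"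
        by (simp add: B_def Suc sum.lessThan_Suc_shift del: sum.lessThan_Suc)
      then show ?thesis by (metis laurent_ideal_zero)
    qed
  next
    case (Suc n)
    then show ?case using step by auto
  qed
  then obtain C where C: "\<And>n. \<beta> ^ n - B (C n) \<in> ?I"
    by metis
  \<comment> \<open>Restricted to indices below \<open>d\<close>, the reduced coefficient functions form a finite set.\<close>
  define C' where "C' = (\<lambda>n. \<lambda>i\<in>{..<d}. C n i mod int l)"
  have C': "\<beta> ^ n - B (C' n) \<in> ?I" for n
  proof -
    have "B (C n) - B (C' n) = (\<Sum>i<d. of_int (C n i - C n i mod int l) * \<beta> ^ i)"
      by (simp add: B_def C'_def sum_subtractf [symmetric] algebra_simps)
    also have "\<dots> \<in> ?I"
      by (intro laurent_ideal_sum laurent_ideal_of_int laurent_ring_power) auto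
    finally have "(\<beta> ^ n - B (C n)) + (B (C n) - B (C' n)) \<in> ?I"
      by (intro laurent_ideal_add C)
    then show ?thesis by simp
  qed
  have "range C' \<subseteq> {..<d} \<rightarrow>\<^sub>E {0..<int l}"
    using \<open>Factorial_Ring.prime l\<close> prime_gt_0_nat[of l] by (auto simp: C'_def PiE_def)
  then have "finite (range C')"
    by (rule finite_subset) (auto intro: finite_PiE)
  then have "\<not> inj C'"
    using finite_imageD[of C' UNIV] by auto
  then obtain i j where ij: "i < j" "C' i = C' j"
    by (metis injI linorder_neqE_nat)
  have "\<beta> ^ j - \<beta> ^ i \<in> ?I"
    using laurent_ideal_diff[OF C'[of j] C'[of i]] ij by simp
  then obtain h where h: "h \<in> laurent_ring \<beta>" "\<beta> ^ j - \<beta> ^ i = of_nat l * h"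
    by (elim laurent_idealE)
  have "\<beta> ^ (j - i) - 1 = of_nat l * (h / \<beta> ^ i)"
    using h(2) ij \<open>\<beta> \<noteq> 0\<close> by (simp add: power_diff field_simps)
  then have "\<beta> ^ (j - i) - 1 \<in> ?I"
    using laurent_idealI[OF laurent_ring_divide_power[OF h(1)]] by metis
  then show thesis
    using that[of "j - i"] ij by simp
qed

lemma laurent_ideal_power_diff_one:
  assumes "x - 1 \<in> laurent_ideal \<beta> q" "x \<in> laurent_ring \<beta>"
  shows "x ^ n - 1 \<in> laurent_ideal \<beta> q"
proof -
  have "x ^ k \<in> laurent_ring \<beta>" for k
    by (induction k) (auto intro: laurent_ring.one laurent_ring_mult assms)
  then show ?thesis
    unfolding power_diff_1_eq by (intro laurent_ideal_mult assms laurent_ring_sum)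
qed

text \<open>
  With \<open>c = \<beta>\<^bsup>pr\<^esup>\<close>, which is 1 modulo both \<open>a\<close> and \<open>b\<close>, the first factor of
  \<open>c\<^sup>b - 1 = (c - 1) (1 + c + \<dots> + c\<^bsup>b-1\<^esup>)\<close> is divisible by \<open>a\<close>, and the second is congruent to
  \<open>b\<close>, that is to 0, modulo \<open>b\<close>. The argument allows common factors of \<open>a\<close> and \<open>b\<close>, and so it reaches prime powers.
\<close>
lemma power_eq_one_mod_mult:
  assumes "\<beta> ^ p - 1 \<in> laurent_ideal \<beta> a" "\<beta> ^ r - 1 \<in> laurent_ideal \<beta> b"
  shows "\<beta> ^ (p * r * b) - 1 \<in> laurent_ideal \<beta> (a * b)"
proof -
  define c where "c = \<beta> ^ (p * r)"
  have ca: "c - 1 \<in> laurent_ideal \<beta> a"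
    unfolding c_def power_mult
    by (intro laurent_ideal_power_diff_one assms laurent_ring_power)
  have cb: "c - 1 \<in> laurent_ideal \<beta> b"
    unfolding c_def mult.commute[of p] power_mult
    by (intro laurent_ideal_power_diff_one assms laurent_ring_power)
  have "(\<Sum>i<b. c ^ i) = (\<Sum>i<b. c ^ i - 1) + of_nat b * 1"
    by (simp add: sum_subtractf)
  also have "\<dots> \<in> laurent_ideal \<beta> b"
    by (intro laurent_ideal_add laurent_ideal_sum laurent_ideal_power_diff_one cb laurent_idealI
        laurent_ring.one) (auto simp: c_def laurent_ring_power)
  finally obtain g where g: "g \<in> laurent_ring \<beta>" "(\<Sum>i<b. c ^ i) = of_nat b * g"
    by (elim laurent_idealE)
  obtain h where h: "h \<in> laurent_ring \<beta>" "c - 1 = of_nat a * h"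
    using ca by (elim laurent_idealE)
  have "\<beta> ^ (p * r * b) - 1 = (c - 1) * (\<Sum>i<b. c ^ i)"
    by (simp add: c_def power_mult power_diff_1_eq)
  also have "\<dots> = of_nat (a * b) * (h * g)"
    by (simp add: g h)
  finally show ?thesis
    using laurent_idealI[OF laurent_ring_mult[OF h(1) g(1)], of "a * b"] by simp
qed

text \<open>
  The prime case applies to every prime \<open>l\<close> with the same primitive polynomial; the general modulus is
  built up from its prime factors.
\<close>
lemma power_eq_one_mod:
  assumes "Polynomial.algebraic \<beta>" "\<beta> \<noteq> 0" "q > 0"
  obtains p where "p > 0" "\<beta> ^ p - 1 \<in> laurent_ideal \<beta> q"
proof -
  obtain f :: "int poly" where f: "poly (map_poly of_int f) \<beta> = 0" "f \<noteq> 0"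
    using assms(1) by (elim algebraicE') auto
  define s where "s = primitive_part f"
  have s: "content s = 1"
    using f(2) by (simp add: s_def)
  have "map_poly of_int f = Polynomial.smult (of_int (content f) :: complex) (map_poly of_int s)"
    by (subst content_times_primitive_part[of f, symmetric], unfold s_def)
      (auto intro!: poly_eqI simp: coeff_map_poly simp del: content_times_primitive_part)
  then have root: "poly (map_poly of_int s) \<beta> = 0"
    using f by simp
  have "\<exists>p>0. \<beta> ^ p - 1 \<in> laurent_ideal \<beta> q"
    using \<open>q > 0\<close>
  proof (induction q rule: less_induct)
    case (less q)
    show ?case
    proof (cases "q = 1")
      case True
      have "\<beta> ^ 1 - 1 \<in> laurent_ideal \<beta> q"
        using laurent_idealI[OF laurent_ring_diff[OF laurent_ring_power[of \<beta> 1] laurent_ring.one], of 1] True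
        by simp
      then show ?thesis
        using zero_less_one by blast
    next
      case False
      then obtain l where "Factorial_Ring.prime l" "l dvd q"
        using prime_factor_nat by blast
      then obtain b where b: "q = l * b"
        by (elim dvdE)
      have "l > 1" using \<open>Factorial_Ring.prime l\<close> by (rule prime_gt_1_nat)
      then have "b < q" "b > 0"
        using less.prems b by auto
      then obtain r where r: "r > 0" "\<beta> ^ r - 1 \<in> laurent_ideal \<beta> b"
        using less.IH by blast
      obtain p where p: "p > 0" "\<beta> ^ p - 1 \<in> laurent_ideal \<beta> l"
        using power_eq_one_mod_prime[OF \<open>Factorial_Ring.prime l\<close> s root \<open>\<beta> \<noteq> 0\<close>] by blast
      show ?thesis
        using power_eq_one_mod_mult[OF p(2) r(2)] p(1) r(1) \<open>b > 0\<close> b by (metis nat_0_less_mult_iff)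
    qed
  qed
  then show thesis using that by blast
qed

section \<open>The field \<open>\<rat>(\<beta>)\<close>\<close>

context
begin

interpretation CF: field complex_field
  by (rule field_from_type_algebra)

text \<open>
  The algebraic notions of the statement live in the record-based structure of the complex numbers. These
  facts translate its operations, and its polynomials (coefficient lists with the leading coefficient first),
  to those of the type class.
\<close>
lemma complex_field_simps:
  "carrier complex_field = UNIV" "\<one>\<^bsub>complex_field\<^esub> = 1" "\<zero>\<^bsub>complex_field\<^esub> = 0"
  "x \<oplus>\<^bsub>complex_field\<^esub> y = x + y" "x \<otimes>\<^bsub>complex_field\<^esub> y = x * y"
  by (simp_all add: ring_of_type_algebra_def)

lemma complex_field_minus: "\<ominus>\<^bsub>complex_field\<^esub> x = - x"
  by (rule CF.minus_equality) (auto simp: complex_field_simps)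

lemma complex_field_inverse:
  assumes "x \<noteq> 0"
  shows "inv\<^bsub>complex_field\<^esub> x = inverse x"
  by (rule CF.comm_inv_char) (use assms in \<open>auto simp: complex_field_simps\<close>)

lemma complex_field_power: "x [^]\<^bsub>complex_field\<^esub> (n :: nat) = x ^ n"
  by (induction n) (simp_all add: complex_field_simps mult.commute)

lemma complex_field_eval: "CF.eval p z = poly (Poly (rev p)) z"
  by (induction p)
    (simp_all add: complex_field_simps complex_field_power Poly_append poly_monom algebra_simps)

lemma subfield_rat: "subfield \<rat> complex_field"
  by (intro CF.subfieldI' CF.subringI)
    (auto simp: complex_field_simps complex_field_minus complex_field_inverse)

lemma algebraic_over_rat:
  assumes "Polynomial.algebraic \<beta>"
  shows "(CF.algebraic over \<rat>) \<beta>"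
proof -
  obtain p where p: "\<And>i. poly.coeff p i \<in> \<int>" "p \<noteq> 0" "poly p \<beta> = 0"
    using assms by (elim algebraicE) auto
  have "set (coeffs p) \<subseteq> \<rat>"
    using p(1) Ints_subset_Rats by (auto simp: coeffs_def)
  then have "polynomial\<^bsub>complex_field\<^esub> \<rat> (rev (coeffs p))"
    using p(2) by (auto simp: polynomial_def complex_field_simps hd_rev last_coeffs_eq_coeff_degree)
  then show ?thesis
    using p by (intro CF.algebraicI[of "rev (coeffs p)"])
      (auto simp: univ_poly_carrier complex_field_eval complex_field_simps)
qed

lemma clear_denominators:
  assumes "\<And>i. poly.coeff p i \<in> \<rat>"
  shows "\<exists>N>0. int_coeffs (Polynomial.smult (of_nat N) p)"
  using assms
proof (induction p)
  case 0
  then show ?case by (auto simp: int_coeffs_def)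
next
  case (pCons a p)
  have "poly.coeff p i \<in> \<rat>" for i
    using pCons.prems[of "Suc i"] by simp
  then obtain N where N: "N > 0" "int_coeffs (Polynomial.smult (of_nat N) p)"
    using pCons.IH by blast
  have "a \<in> \<rat>"
    using pCons.prems[of 0] by simp
  then obtain m n where mn: "n > 0" "a = of_int m / of_int n"
    by (elim Rats_cases')
  have "of_nat (nat n * N) * a = of_int (m * int N)"
    using mn by simp
  then have "of_nat (nat n * N) * a \<in> \<int>"
    by (metis Ints_of_int)
  moreover have "int_coeffs (Polynomial.smult (of_nat (nat n * N)) p)"
    unfolding int_coeffs_def
  proof
    fix i
    have "of_nat (nat n) * poly.coeff (Polynomial.smult (of_nat N) p) i \<in> \<int>"
      using N(2) by (intro Ints_mult) (auto simp: int_coeffs_def)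
    then show "poly.coeff (Polynomial.smult (of_nat (nat n * N)) p) i \<in> \<int>"
      by (simp add: mult.assoc)
  qed
  ultimately have "int_coeffs (Polynomial.smult (of_nat (nat n * N)) (pCons a p))"
    by (simp only: smult_pCons int_coeffs_pCons)
  then show ?case
    using N mn by (intro exI[of _ "nat n * N"]) auto
qed

text \<open>
  The minimal polynomial with its denominators cleared.
\<close>
lemma galois_conjugates_int_poly:
  assumes "Polynomial.algebraic \<beta>"
  obtains f where "int_coeffs f" "f \<noteq> 0" "poly f \<beta> = 0"
    "\<And>z. poly f z = 0 \<Longrightarrow> z \<in> galois_conjugates \<beta>"
proof -
  define P where "P = CF.Irr \<rat> \<beta>"
  note Irr = CF.IrrE[OF subfield_rat _ algebraic_over_rat[OF assms], folded P_def]
  have P: "set P \<subseteq> \<rat>" "P \<noteq> []" "hd P = 1"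
    using Irr(1-3) CF.pirreducibleE(1)[OF subfieldE(1)[OF subfield_rat], of P]
    by (auto simp: complex_field_simps univ_poly_carrier [symmetric] polynomial_def)
  define g where "g = Poly (rev P)"
  have "poly.coeff g i \<in> \<rat>" for i
  proof -
    have "nth_default 0 (rev P) i \<in> \<rat>"
      using P(1) nth_mem[of i "rev P"] by (auto simp: nth_default_def simp del: nth_mem)
    then show ?thesis by (simp add: g_def)
  qed
  then obtain N where N: "N > 0" "int_coeffs (Polynomial.smult (of_nat N) g)"
    using clear_denominators by blast
  have "poly.coeff g (length P - 1) = 1"
    using P(2,3) by (simp add: g_def nth_default_def rev_nth hd_conv_nth)
  then have "g \<noteq> 0" by auto
  show thesis
  proof (rule that[OF N(2)])
    show "poly (Polynomial.smult (of_nat N) g) \<beta> = 0"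
      using Irr(4) by (simp add: complex_field_simps complex_field_eval g_def)
  next
    fix z assume "poly (Polynomial.smult (of_nat N) g) z = 0"
    then show "z \<in> galois_conjugates \<beta>"
      using N(1) by (simp add: galois_conjugates_def complex_field_eval g_def P_def)
  qed (use N \<open>g \<noteq> 0\<close> in auto)
qed

lemma rat_adjoin_base: "\<beta> \<in> rat_adjoin \<beta>"
  by (simp add: rat_adjoin_def generate_field.incl)

lemma rat_adjoin_one: "1 \<in> rat_adjoin \<beta>"
  using generate_field.one[of complex_field "{\<beta>}"] by (simp add: rat_adjoin_def complex_field_simps)

lemma rat_adjoin_add: "x \<in> rat_adjoin \<beta> \<Longrightarrow> y \<in> rat_adjoin \<beta> \<Longrightarrow> x + y \<in> rat_adjoin \<beta>"
  using generate_field.eng_add[of x complex_field "{\<beta>}" y]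
  by (simp add: rat_adjoin_def complex_field_simps)

lemma rat_adjoin_mult: "x \<in> rat_adjoin \<beta> \<Longrightarrow> y \<in> rat_adjoin \<beta> \<Longrightarrow> x * y \<in> rat_adjoin \<beta>"
  using generate_field.eng_mult[of x complex_field "{\<beta>}" y]
  by (simp add: rat_adjoin_def complex_field_simps)

lemma rat_adjoin_neg: "x \<in> rat_adjoin \<beta> \<Longrightarrow> - x \<in> rat_adjoin \<beta>"
  using generate_field.a_inv[of x complex_field "{\<beta>}"]
  by (simp add: rat_adjoin_def complex_field_minus)

lemma rat_adjoin_zero: "0 \<in> rat_adjoin \<beta>"
  using rat_adjoin_add[OF rat_adjoin_one rat_adjoin_neg[OF rat_adjoin_one]] by simp

lemma rat_adjoin_inverse: "x \<in> rat_adjoin \<beta> \<Longrightarrow> inverse x \<in> rat_adjoin \<beta>"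
  using generate_field.m_inv[of x complex_field "{\<beta>}"] rat_adjoin_zero
  by (cases "x = 0") (auto simp: rat_adjoin_def complex_field_simps complex_field_inverse)

lemma rat_adjoin_power: "x \<in> rat_adjoin \<beta> \<Longrightarrow> x ^ n \<in> rat_adjoin \<beta>"
  by (induction n) (auto intro: rat_adjoin_one rat_adjoin_mult)

lemma rat_adjoin_powi: "x \<in> rat_adjoin \<beta> \<Longrightarrow> x powi n \<in> rat_adjoin \<beta>"
  by (auto simp: power_int_def intro: rat_adjoin_power rat_adjoin_inverse)

lemma rat_adjoin_sum: "(\<And>i. i \<in> I \<Longrightarrow> f i \<in> rat_adjoin \<beta>) \<Longrightarrow> sum f I \<in> rat_adjoin \<beta>"
  by (induction I rule: infinite_finite_induct) (auto intro: rat_adjoin_zero rat_adjoin_add)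

lemma rat_adjoin_of_int: "of_int a \<in> rat_adjoin \<beta>"
proof -
  have "of_nat n \<in> rat_adjoin \<beta>" for n
    by (induction n) (auto intro: rat_adjoin_zero rat_adjoin_one rat_adjoin_add)
  then show ?thesis
    by (cases a rule: int_cases2) (auto intro: rat_adjoin_neg)
qed

text \<open>
  For algebraic \<open>\<beta>\<close> the polynomial expressions in \<open>\<beta>\<close> over \<open>\<rat>\<close> already form a field, which therefore
  contains \<open>\<rat>(\<beta>)\<close>; and such an expression has a common denominator.
\<close>
lemma rat_adjoin_fraction:
  assumes "Polynomial.algebraic \<beta>" and x: "x \<in> rat_adjoin \<beta>"
  obtains q :: nat where "q > 0" "of_nat q * x \<in> laurent_ring \<beta>"
proof -
  have "subfield (CF.simple_extension \<rat> \<beta>) complex_field"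
    using CF.simple_extension_is_subfield[OF subfield_rat] algebraic_over_rat[OF assms(1)]
    by (simp add: complex_field_simps)
  moreover have "\<beta> \<in> CF.simple_extension \<rat> \<beta>"
    using CF.simple_extension_mem[OF subfieldE(1)[OF subfield_rat]]
    by (simp add: complex_field_simps)
  ultimately have "rat_adjoin \<beta> \<subseteq> CF.simple_extension \<rat> \<beta>"
    unfolding rat_adjoin_def
    by (intro CF.generate_field_min_subfield1) (auto simp: complex_field_simps)
  then have "x \<in> CF.simple_extension \<rat> \<beta>"
    using x by blast
  then have "\<exists>q>0. of_nat q * x \<in> laurent_ring \<beta>"
  proof (induction rule: CF.simple_extension.induct)
    case zero
    show ?case
      by (intro exI[of _ 1]) (auto simp: complex_field_simps laurent_ring_zero)
  next
    case (lin k1 k2)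
    then obtain q where q: "q > 0" "of_nat q * k1 \<in> laurent_ring \<beta>"
      by blast
    obtain m n where mn: "n > 0" "k2 = of_int m / of_int n"
      using lin(2) by (elim Rats_cases')
    have "of_nat (nat n * q) * (k1 * \<beta> + k2) =
       of_nat (nat n) * (\<beta> * (of_nat q * k1)) + of_int (m * int q)"
      using mn by (simp add: algebra_simps)
    also have "\<dots> \<in> laurent_ring \<beta>"
      by (rule laurent_ring.add[OF laurent_ring_mult[OF laurent_ring_of_nat laurent_ring.mult_base[OF q(2)]]
            laurent_ring_of_int])
    finally show ?case
      using q(1) mn(1) by (intro exI[of _ "nat n * q"]) (auto simp: complex_field_simps)
  qed
  then show thesis using that by blast
qed

end

section \<open>Expansions of the elements of \<open>\<rat>(\<beta>)\<close>\<close>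

text \<open>
  Numbers with an eventually periodic representation by arbitrary integer digits. The factor \<open>w\<^sup>L\<close>
  moves the digits at positive powers of \<open>\<beta> = 1 / w\<close> into the range of a power series.
\<close>
definition representable :: "complex \<Rightarrow> complex set" where
  "representable w = {x. \<exists>L z. ev_periodic z \<and> w ^ L * x = expansion w z}"

context
  fixes w :: complex
  assumes w: "norm w < 1" "w \<noteq> 0"
begin

lemma representable_add:
  assumes "x \<in> representable w" "y \<in> representable w"
  shows "x + y \<in> representable w"
proof -
  obtain L z where z: "ev_periodic z" "w ^ L * x = expansion w z"
    using assms(1) by (auto simp: representable_def)
  obtain K u where u: "ev_periodic u" "w ^ K * y = expansion w u"
    using assms(2) by (auto simp: representable_def)
  have "w ^ (K + L) * (x + y) = w ^ K * (w ^ L * x) + w ^ L * (w ^ K * y)"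
    by (simp add: power_add algebra_simps)
  also have "\<dots> = expansion w (\<lambda>k. shift K z k + shift L u k)"
    using z u w(1) by (simp add: expansion_add expansion_shift ev_periodic_shift)
  finally show ?thesis
    using ev_periodic_combine[OF ev_periodic_shift[OF z(1)] ev_periodic_shift[OF u(1)]]
    unfolding representable_def by blast
qed

lemma representable_neg:
  assumes "x \<in> representable w"
  shows "- x \<in> representable w"
proof -
  obtain L z where z: "ev_periodic z" "w ^ L * x = expansion w z"
    using assms(1) by (auto simp: representable_def)
  have "w ^ L * (- x) = expansion w (\<lambda>k. (-1) * z k)"
    using z w(1) by (subst expansion_mult) auto
  then show ?thesis
    using ev_periodic_comp[OF z(1), of "\<lambda>a. (-1) * a"] unfolding representable_def by blast
qed

lemma representable_mult_base:
  assumes "x \<in> representable w"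
  shows "w * x \<in> representable w"
proof -
  obtain L z where z: "ev_periodic z" "w ^ L * x = expansion w z"
    using assms(1) by (auto simp: representable_def)
  have "w ^ L * (w * x) = expansion w (shift 1 z)"
    using z w(1) by (simp add: expansion_shift mult_ac)
  then show ?thesis
    using ev_periodic_shift[OF z(1), of 1] unfolding representable_def by blast
qed

lemma representable_divide_base:
  assumes "x \<in> representable w"
  shows "x / w \<in> representable w"
proof -
  obtain L z where z: "ev_periodic z" "w ^ L * x = expansion w z"
    using assms(1) by (auto simp: representable_def)
  have "w ^ Suc L * (x / w) = expansion w z"
    using z w(2) by simp
  then show ?thesis
    using z(1) unfolding representable_def by blast
qed

text \<open>
  As the digits are not restricted to an alphabet, the set is closed under digitwise addition and under
  shifts, and is thus a module over \<open>\<int>[\<beta>, 1/\<beta>]\<close>.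
\<close>
lemma representable_laurent_mult:
  assumes "a \<in> laurent_ring (1 / w)" "x \<in> representable w"
  shows "a * x \<in> representable w"
  using assms
proof (induction a rule: laurent_ring.induct)
  case (mult_base a)
  then show ?case
    using representable_divide_base[of "a * x"] by simp
next
  case (divide_base a)
  then show ?case
    using representable_mult_base[of "a * x"] by (simp add: mult_ac)
qed (auto simp: ring_distribs intro: representable_add representable_neg)

lemma representable_geometric:
  assumes "p > 0"
  shows "1 / (1 - w ^ p) \<in> representable w"
proof -
  define z :: "nat \<Rightarrow> int" where "z = (\<lambda>k. if p dvd k then 1 else 0)"
  have z: "ev_periodic z"
    unfolding ev_periodic_def by (rule exI[of _ 0], rule exI[of _ p]) (simp add: z_def assms)
  have "z = (\<lambda>k. shift p z k + (if k = 0 then 1 else 0))"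
  proof
    fix k
    show "z k = shift p z k + (if k = 0 then 1 else 0)"
    proof (cases "k < p")
      case True
      then show ?thesis
        using assms by (auto simp: z_def shift_def dest: dvd_imp_le)
    next
      case False
      then show ?thesis
        using assms by (simp add: z_def shift_def dvd_minus_self)
    qed
  qed
  then have "expansion w z = expansion w (\<lambda>k. shift p z k + (if k = 0 then 1 else 0))"
    by (rule arg_cong[where f = "expansion w"])
  also have "\<dots> = w ^ p * expansion w z + expansion w (\<lambda>k. if k = 0 then 1 else 0)"
  proof -
    have "ev_periodic (\<lambda>k :: nat. if k = 0 then 1 else 0 :: int)"
      unfolding ev_periodic_def by (intro exI[of _ "1 :: nat"] conjI allI impI) auto
    then show ?thesis
      by (simp only: expansion_add[OF w(1) ev_periodic_shift[OF z]] expansion_shift[OF w(1) z])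
  qed
  also have "expansion w (\<lambda>k. if k = 0 then 1 else 0) = 1"
    unfolding expansion_def by (subst suminf_finite[of "{0}"]) auto
  finally have eq: "expansion w z = w ^ p * expansion w z + 1" .
  have "expansion w z * (1 - w ^ p) = expansion w z - w ^ p * expansion w z"
    by (simp add: right_diff_distrib mult.commute)
  also have "\<dots> = 1"
    by (simp only: diff_eq_eq) (rule trans[OF eq add.commute])
  finally have *: "expansion w z * (1 - w ^ p) = 1" .
  then have ne: "1 - w ^ p \<noteq> 0"
    by (metis mult_zero_right zero_neq_one)
  have "w ^ 0 * (1 / (1 - w ^ p)) = expansion w z"
    by (simp only: power_0 mult_1_left nonzero_divide_eq_eq[OF ne] *)
  with z show ?thesis
    unfolding representable_def by blast
qed

end

text \<open>
  If \<open>q x\<close> lies in \<open>\<int>[\<beta>, 1/\<beta>]\<close> and \<open>\<beta>\<^sup>p - 1 = q h\<close>, then \<open>x = (q x) h / (\<beta>\<^sup>p - 1)\<close>. So division by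
  \<open>q\<close> becomes division by \<open>\<beta>\<^sup>p - 1\<close>, which amounts to the purely periodic expansion
  \<open>1 / (1 - w\<^sup>p) = 1 + w\<^sup>p + w\<^bsup>2p\<^esup> + \<dots>\<close> with \<open>w = 1/\<beta>\<close>.
\<close>
lemma rat_adjoin_representable:
  assumes alg: "Polynomial.algebraic \<beta>" and norm: "norm \<beta> > 1" and x: "x \<in> rat_adjoin \<beta>"
  shows "x \<in> representable (1 / \<beta>)"
proof -
  have "\<beta> \<noteq> 0" using norm by auto
  have w: "norm (1 / \<beta>) < 1" "1 / \<beta> \<noteq> 0"
    using norm by (auto simp: norm_divide divide_simps)
  obtain q :: nat where q: "q > 0" "of_nat q * x \<in> laurent_ring \<beta>"
    using rat_adjoin_fraction[OF alg x] by blast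
  obtain p where p: "p > 0" "\<beta> ^ p - 1 \<in> laurent_ideal \<beta> q"
    using power_eq_one_mod[OF alg \<open>\<beta> \<noteq> 0\<close> q(1)] by blast
  then obtain h where h: "h \<in> laurent_ring \<beta>" "\<beta> ^ p - 1 = of_nat q * h"
    by (elim laurent_idealE)
  have ne: "\<beta> ^ p \<noteq> 1"
    using one_less_power[OF norm p(1)] by (metis less_irrefl norm_one norm_power)
  have "(of_nat q * x * h / \<beta> ^ p) * (1 / (1 - (1 / \<beta>) ^ p)) \<in> representable (1 / \<beta>)"
    using w p(1) q(2) h(1)
    by (intro representable_laurent_mult representable_geometric laurent_ring_divide_power
        laurent_ring_mult) (simp_all add: laurent_ring_divide_power laurent_ring_mult)
  also have "(of_nat q * x * h / \<beta> ^ p) * (1 / (1 - (1 / \<beta>) ^ p)) = x * (of_nat q * h) / (\<beta> ^ p - 1)"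
    using \<open>\<beta> \<noteq> 0\<close> ne by (simp add: field_simps)
  also have "\<dots> = x"
    using ne by (simp add: h(2) [symmetric])
  finally show ?thesis .
qed

text \<open>
  Multiplication by \<open>1 - w\<^sup>p\<close>, with \<open>p\<close> the period, subtracts from the digit sequence its shift by \<open>p\<close> and leaves
  only finitely many nonzero digits.
\<close>
lemma expansion_in_rat_adjoin:
  assumes norm: "norm \<beta> > 1" and z: "ev_periodic z"
  shows "expansion (1 / \<beta>) z \<in> rat_adjoin \<beta>"
proof -
  define w where "w = 1 / \<beta>"
  have w: "norm w < 1"
    using norm by (auto simp: w_def norm_divide divide_simps)
  have wQ: "w \<in> rat_adjoin \<beta>"
    using rat_adjoin_inverse[OF rat_adjoin_base] by (simp add: w_def inverse_eq_divide)
  obtain N p where p: "p > 0" "\<And>k. k \<ge> N \<Longrightarrow> z (k + p) = z k"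
    using z by (auto simp: ev_periodic_def)
  have ne: "w ^ p \<noteq> 1"
    using p(1) w by (metis less_irrefl norm_one norm_power power_less_one_iff norm_ge_zero)
  define y where "y = (\<lambda>k. z k + (-1) * shift p z k)"
  have nz: "ev_periodic (\<lambda>k. (-1) * shift p z k)"
    by (rule ev_periodic_comp[OF ev_periodic_shift[OF z]])
  have "expansion w y = (1 - w ^ p) * expansion w z"
    unfolding y_def expansion_add[OF w z nz] expansion_mult[OF w ev_periodic_shift[OF z]]
      expansion_shift[OF w z] by (simp add: algebra_simps)
  moreover have "expansion w y = (\<Sum>k<N + p. of_int (y k) * w ^ k)"
    unfolding expansion_def
  proof (rule suminf_finite)
    fix k assume "k \<notin> {..<N + p}"
    then have "y k = 0"
      using p(2)[of "k - p"] by (simp add: y_def shift_def)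
    then show "of_int (y k) * w ^ k = 0" by simp
  qed simp
  ultimately have "expansion w z = (\<Sum>k<N + p. of_int (y k) * w ^ k) * inverse (1 + - (w ^ p))"
    using ne by (simp add: field_simps)
  also have "\<dots> \<in> rat_adjoin \<beta>"
    by (intro rat_adjoin_mult rat_adjoin_sum rat_adjoin_inverse rat_adjoin_add rat_adjoin_neg
        rat_adjoin_power rat_adjoin_one rat_adjoin_of_int wQ)
  finally show ?thesis by (simp add: w_def)
qed

lemma infsum_digits_eq_expansion:
  assumes norm: "norm \<beta> > 1" and z: "ev_periodic z"
  shows "(\<Sum>\<^sub>\<infinity>k\<in>{-L..}. of_int (z (nat (k + L))) * \<beta> powi (-k)) = \<beta> powi L * expansion (1 / \<beta>) z"
proof -
  have w: "norm (1 / \<beta>) < 1"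
    using norm by (auto simp: norm_divide divide_simps)
  have "\<beta> \<noteq> 0" using norm by auto
  have bij: "bij_betw (\<lambda>n. int n - L) UNIV {-L..}"
    by (rule bij_betw_byWitness[of _ "\<lambda>k. nat (k + L)"]) auto
  have "(\<Sum>\<^sub>\<infinity>k\<in>{-L..}. of_int (z (nat (k + L))) * \<beta> powi (-k)) =
      (\<Sum>\<^sub>\<infinity>n\<in>UNIV. of_int (z n) * \<beta> powi (L - int n))"
    by (subst infsum_reindex_bij_betw[OF bij, symmetric]) simp
  also have "\<dots> = (\<Sum>\<^sub>\<infinity>n\<in>UNIV. \<beta> powi L * (of_int (z n) * (1 / \<beta>) ^ n))"
    using \<open>\<beta> \<noteq> 0\<close> by (intro infsum_cong) (simp add: power_int_diff power_one_over field_simps)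
  also have "\<dots> = \<beta> powi L * (\<Sum>\<^sub>\<infinity>n\<in>UNIV. of_int (z n) * (1 / \<beta>) ^ n)"
    by (rule infsum_cmult_right')
  also have "(\<Sum>\<^sub>\<infinity>n\<in>UNIV. of_int (z n) * (1 / \<beta>) ^ n) = expansion (1 / \<beta>) z"
    by (intro infsumI norm_summable_imp_has_sum expansion_norm_summable expansion_sums w z)
  finally show ?thesis .
qed

theorem theorem1p1:
  fixes \<beta> :: complex
  assumes "algebraic \<beta>"
    and "norm \<beta> > 1"
    and "\<And>\<beta>'. \<beta>' \<in> galois_conjugates \<beta> \<Longrightarrow> norm \<beta>' \<noteq> 1"
  shows "\<exists>A. alphabet A \<and> A \<subseteq> \<int> \<and> Per A \<beta> = rat_adjoin \<beta>"
proof -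
  define w where "w = 1 / \<beta>"
  have "\<beta> \<noteq> 0" and w: "norm w < 1"
    using assms(2) by (auto simp: w_def norm_divide divide_simps)
  obtain f where f: "int_coeffs f" "f \<noteq> 0" "poly f \<beta> = 0"
    "\<And>z. poly f z = 0 \<Longrightarrow> z \<in> galois_conjugates \<beta>"
    using galois_conjugates_int_poly[OF assms(1)] by blast
  have unit: "norm z \<noteq> 1" if "poly f z = 0" for z
    using f(4)[OF that] assms(3) by blast
  obtain s d e n where s: "e \<le> d" "n > 0" "2 * (\<Sum>i\<in>{..d} - {e}. \<bar>s i\<bar>) < \<bar>s e\<bar>"
    "(\<Sum>i\<le>d. of_int (s i) * \<beta> ^ (n * i)) = 0"
    by (rule dominant_integer_relation[OF f(1-3) unit])
  \<comment> \<open>The relation times \<open>w\<^bsup>nd\<^esup>\<close>, so that only nonnegative powers of \<open>w\<close> occur.\<close>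
  have rel: "(\<Sum>i\<in>{..d}. of_int (s i) * w ^ (n * (d - i))) = 0"
  proof -
    have "(\<Sum>i\<in>{..d}. of_int (s i) * w ^ (n * (d - i))) =
        (\<Sum>i\<le>d. w ^ (n * d) * (of_int (s i) * \<beta> ^ (n * i)))"
      using \<open>\<beta> \<noteq> 0\<close>
      by (intro sum.cong) (auto simp: w_def right_diff_distrib' power_diff power_one_over field_simps)
    also have "\<dots> = 0"
      by (simp only: sum_distrib_left [symmetric] s(4) mult_zero_right)
    finally show ?thesis .
  qed
  define M where "M = 3 * \<bar>s e\<bar>"
  define A where "A = (of_int ` {-M..M} :: complex set)"
  have "alphabet A" "A \<subseteq> \<int>"
    by (auto simp: A_def alphabet_def M_def image_iff)
  moreover have "Per A \<beta> \<subseteq> rat_adjoin \<beta>"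
  proof
    fix x assume "x \<in> Per A \<beta>"
    then obtain L a where x: "x = (\<Sum>\<^sub>\<infinity>k\<in>{-L..}. a k * \<beta> powi (-k))"
      and a: "\<forall>k\<ge>-L. a k \<in> A" "eventually_periodic_from (-L) a"
      unfolding Per_def mem_Collect_eq by (elim exE conjE) (rule that)
    \<comment> \<open>The digits are integers given as complex numbers; the real part and the floor recover them.\<close>
    define z where "z = (\<lambda>n. \<lfloor>Re (a (int n - L))\<rfloor>)"
    have az: "a k = of_int (z (nat (k + L)))" if "k \<ge> -L" for k
      using a(1)[rule_format, OF that] that by (auto simp: z_def A_def)
    obtain N p where Np: "p > 0" "N \<ge> -L" "\<And>k. k \<ge> N \<Longrightarrow> a (k + p) = a k"
      using a(2) by (auto simp: eventually_periodic_from_def)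
    have z: "ev_periodic z"
      unfolding ev_periodic_def
    proof (rule exI[of _ "nat (N + L)"], rule exI[of _ "nat p"], intro conjI allI impI)
      fix k assume "k \<ge> nat (N + L)"
      then show "z (k + nat p) = z k"
        using Np(3)[of "int k - L"] Np(1) by (simp add: z_def algebra_simps)
    qed (use Np in auto)
    have "x = (\<Sum>\<^sub>\<infinity>k\<in>{-L..}. of_int (z (nat (k + L))) * \<beta> powi (-k))"
      unfolding x by (intro infsum_cong) (simp add: az)
    also have "\<dots> = \<beta> powi L * expansion (1 / \<beta>) z"
      by (rule infsum_digits_eq_expansion[OF assms(2) z])
    also have "\<dots> \<in> rat_adjoin \<beta>"
      by (intro rat_adjoin_mult rat_adjoin_powi rat_adjoin_base expansion_in_rat_adjoin assms(2) z)
    finally show "x \<in> rat_adjoin \<beta>" .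
  qed
  moreover have "rat_adjoin \<beta> \<subseteq> Per A \<beta>"
  proof
    fix x assume "x \<in> rat_adjoin \<beta>"
    then have "x \<in> representable w"
      unfolding w_def by (rule rat_adjoin_representable[OF assms(1,2)])
    then obtain L z where z: "ev_periodic z" "w ^ L * x = expansion w z"
      by (auto simp: representable_def)
    obtain y K where y: "ev_periodic y" "\<And>k. \<bar>y k\<bar> \<le> M" "expansion w y = w ^ K * expansion w z"
      using digit_reduction[OF w _ _ rel s(3) z(1)] s(1) unfolding M_def by auto
    define I where "I = int (K + L)"
    define a :: "int \<Rightarrow> complex" where "a = (\<lambda>k. of_int (y (nat (k + I))))"
    have "(\<Sum>\<^sub>\<infinity>k\<in>{-I..}. a k * \<beta> powi (-k)) = \<beta> powi I * expansion w y"
      unfolding a_def w_def by (rule infsum_digits_eq_expansion[OF assms(2) y(1)])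
    also have "\<dots> = x"
      using \<open>\<beta> \<noteq> 0\<close> unfolding y(3) z(2) [symmetric]
      by (simp add: I_def w_def power_add power_one_over field_simps del: of_nat_add)
    finally have x: "x = (\<Sum>\<^sub>\<infinity>k\<in>{-I..}. a k * \<beta> powi (-k))" ..
    have aA: "\<forall>k\<ge>-I. a k \<in> A"
    proof (intro allI impI)
      fix k
      have "y (nat (k + I)) \<in> {-M..M}"
        using y(2)[of "nat (k + I)"] by auto
      then show "a k \<in> A"
        by (simp add: a_def A_def)
    qed
    obtain N p where Np: "p > 0" "\<And>k. k \<ge> N \<Longrightarrow> y (k + p) = y k"
      using y(1) by (auto simp: ev_periodic_def)
    have "eventually_periodic_from (-I) a"
      unfolding eventually_periodic_from_def
    proof (rule exI[of _ "int N - I"], rule conjI, simp, rule exI[of _ "int p"], intro conjI allI impI)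
      fix k assume k: "k \<ge> int N - I"
      then have "nat (k + int p + I) = nat (k + I) + p" "nat (k + I) \<ge> N"
        by auto
      then show "a (k + int p) = a k"
        using Np(2) by (simp add: a_def)
    qed (use Np in auto)
    with aA x have "x = (\<Sum>\<^sub>\<infinity>k\<in>{-I..}. a k * \<beta> powi (-k)) \<and>
        (\<forall>k\<ge>-I. a k \<in> A) \<and> eventually_periodic_from (-I) a"
      by simp
    then show "x \<in> Per A \<beta>"
      unfolding Per_def mem_Collect_eq by (intro exI)
  qed
  ultimately show ?thesis by blast
qed

end
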